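(* Let $F(\nu)=(\nu_1^2-\nu_2^2)(\nu_1^2+\nu_4^2)+\nu_1^2\nu_3^2$ for $\nu\in\mathbb{R}^4$, and let $C=\{\nu\in\mathbb{R}^4 : F(\nu)=0\}$ be the critical set. The boundary of the stability domain of the reduced centralizer unfolding of $L$ transversally intersects the $3$-sphere $\|\nu\|=1$ in the critical surface $S=\{\nu\in\mathbb{R}^4 : F(\nu)=0 \text{ and } \|\nu\|=1\}$, that is, the intersection is transversal and equals $S$. The critical set $C$ is a (straight) cone over the critical surface $S$, i.e. $C=\{t\xi : t\ge0,\ \xi\in S\}$.
   Context: Let $I=\begin{pmatrix}1&0\\0&1\end{pmatrix}$, $R=\begin{pmatrix}1&0\\0&-1\end{pmatrix}$, $J=\begin{pmatrix}0&1\\-1&0\end{pmatrix}$, and (in $2\times2$ blocks) $M_1=\begin{pmatrix}I&0\\0&I\end{pmatrix}$, $M_4=\begin{pmatrix}0&J\\-J&0\end{pmatrix}$, $M_5=L=\begin{pmatrix}0&I\\-I&0\end{pmatrix}$, $M_6=\begin{pmatrix}0&R\\-R&0\end{pmatrix}$, $M_8=\begin{pmatrix}J&0\\0&J\end{pmatrix}$. The reduced centralizer unfolding of $L$, in homogeneous form, is $H_r(\nu)=\nu_1M_1+\nu_2M_4+\nu_3M_6+\nu_4M_8+\nu_5M_5$, where $\nu_5$ has a fixed non-zero value and $\nu=(\nu_1,\ldots,\nu_4)\in\mathbb{R}^4$. Its stability domain is the set of $\nu\in\mathbb{R}^4$ for which every eigenvalue of $H_r(\nu)$ has negative real part, and the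 boundary is the topological boundary in $\mathbb{R}^4$. A (possibly singular) closed hypersurface $X\subset\mathbb{R}^4$ is said to intersect the unit sphere transversally if at each intersection point $p$ the tangent cone of $X$ at $p$ is not contained in the tangent space of the sphere at $p$ (at smooth points of $X$ this is ordinary transversality). $\|\cdot\|$ is the Euclidean norm.
   Formalization: The boundary does not meet the sphere in all of S (e.g. (1,1,0,0)/√2 is in S, not in the boundary). Proved: it meets it exactly in the points of S with ν₁≤0 and, if ν₁=0, ν₂²≤ν₃²+ν₄². Transversality is shown for the boundary and for C. *)

theory Defs
  imports "HOL-Analysis.Analysis" "Jordan_Normal_Form.Char_Poly"
begin

unbundle no vec_syntax
no_notation inner (infix "\<bullet>" 70)

text \<open>
  Two matrix libraries meet here: parameters \<open>\<nu> \<in> \<real>\<^sup>4\<close> are elements of \<open>real ^ 4\<close> (which carries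
  the norm and the topology, with components \<open>vec_nth \<nu> 1\<close> to \<open>vec_nth \<nu> 4\<close>), whereas the
  matrices \<open>M\<^sub>i\<close> are of type \<open>real mat\<close>, which has block matrices and eigenvalues.
\<close>

definition mat_R :: "real mat" where
  "mat_R = mat_of_rows_list 2 [[1, 0], [0, -1]]"

definition mat_J :: "real mat" where
  "mat_J = mat_of_rows_list 2 [[0, 1], [-1, 0]]"

definition M1 :: "real mat" where
  "M1 = four_block_mat (1\<^sub>m 2) (0\<^sub>m 2 2) (0\<^sub>m 2 2) (1\<^sub>m 2)"

definition M4 :: "real mat" where
  "M4 = four_block_mat (0\<^sub>m 2 2) mat_J (- mat_J) (0\<^sub>m 2 2)"

definition M5 :: "real mat" where  \<comment> \<open>the matrix \<open>L\<close> that is unfolded\<close>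
  "M5 = four_block_mat (0\<^sub>m 2 2) (1\<^sub>m 2) (- (1\<^sub>m 2)) (0\<^sub>m 2 2)"

definition M6 :: "real mat" where
  "M6 = four_block_mat (0\<^sub>m 2 2) mat_R (- mat_R) (0\<^sub>m 2 2)"

definition M8 :: "real mat" where
  "M8 = four_block_mat mat_J (0\<^sub>m 2 2) (0\<^sub>m 2 2) mat_J"

definition reduced_unfolding :: "real \<Rightarrow> real ^ 4 \<Rightarrow> real mat" where
  "reduced_unfolding \<nu>5 \<nu> =
     vec_nth \<nu> 1 \<cdot>\<^sub>m M1 + vec_nth \<nu> 2 \<cdot>\<^sub>m M4 + vec_nth \<nu> 3 \<cdot>\<^sub>m M6 + vec_nth \<nu> 4 \<cdot>\<^sub>m M8 + \<nu>5 \<cdot>\<^sub>m M5"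

definition stability_domain :: "real \<Rightarrow> (real ^ 4) set" where
  "stability_domain \<nu>5 =
     {\<nu>. \<forall>c. eigenvalue (map_mat complex_of_real (reduced_unfolding \<nu>5 \<nu>)) c \<longrightarrow> Re c < 0}"

definition crit_fun :: "real ^ 4 \<Rightarrow> real" where
  "crit_fun \<nu> =
     ((vec_nth \<nu> 1)\<^sup>2 - (vec_nth \<nu> 2)\<^sup>2) * ((vec_nth \<nu> 1)\<^sup>2 + (vec_nth \<nu> 4)\<^sup>2)
       + (vec_nth \<nu> 1)\<^sup>2 * (vec_nth \<nu> 3)\<^sup>2"

definition critical_set :: "(real ^ 4) set" where
  "critical_set = {\<nu>. crit_fun \<nu> = 0}"

definition critical_surface :: "(real ^ 4) set" where
  "critical_surface = {\<nu>. crit_fun \<nu> = 0 \<and> norm \<nu> = 1}"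

text \<open>
  Not all of the critical surface is in the boundary of the stability domain.  The eigenvalues of
  the unfolding are \<open>\<nu>\<^sub>1 \<plusminus> \<mu> + i \<nu>\<^sub>5\<close> and their conjugates, where
  \<open>\<mu>\<^sup>2 = \<nu>\<^sub>2\<^sup>2 - \<nu>\<^sub>3\<^sup>2 - \<nu>\<^sub>4\<^sup>2 - 2 i \<nu>\<^sub>2 \<nu>\<^sub>4\<close>, and
  \<open>crit_fun \<nu> = (\<nu>\<^sub>1\<^sup>2 - (Re \<mu>)\<^sup>2) (\<nu>\<^sub>1\<^sup>2 + (Im \<mu>)\<^sup>2)\<close>.  The boundary is
  \<open>\<nu>\<^sub>1 = - \<bar>Re \<mu>\<bar>\<close>.  It misses the critical points with \<open>\<nu>\<^sub>1 > 0\<close>, and those with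
  \<open>\<nu>\<^sub>1 = \<nu>\<^sub>4 = 0\<close> and \<open>\<nu>\<^sub>2\<^sup>2 > \<nu>\<^sub>3\<^sup>2\<close>, where no eigenvalue is purely imaginary.
\<close>

text \<open>
  The tangent cone: limits of rescaled secant vectors \<open>r\<^sub>n (x\<^sub>n - p)\<close> with \<open>x\<^sub>n \<in> X\<close>, \<open>x\<^sub>n \<longlonglongrightarrow> p\<close>, \<open>r\<^sub>n > 0\<close>.
\<close>

definition tangent_cone :: "'a::real_normed_vector set \<Rightarrow> 'a \<Rightarrow> 'a set" where
  "tangent_cone X p =
     {v. \<exists>x r. (\<forall>n::nat. x n \<in> X \<and> (0::real) < r n) \<and> x \<longlonglongrightarrow> p \<and> (\<lambda>n. r n *\<^sub>R (x n - p)) \<longlonglongrightarrow> v}"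

definition transversal_to_unit_sphere :: "'a::real_inner set \<Rightarrow> bool" where
  "transversal_to_unit_sphere X \<longleftrightarrow>
     (\<forall>p \<in> X \<inter> sphere 0 1. \<not> tangent_cone X p \<subseteq> {v. inner p v = 0})"

end

theory Submission
  imports Defs
begin

text \<open>
  The unfolding has the block form \<open>(A, B; - B, A)\<close>, so over the complex numbers its spectrum is
  that of the two \<open>2 \<times> 2\<close> matrices \<open>A + i B\<close> and \<open>A - i B\<close>
  (\<open>eigenvalue_complex_structure_block\<close>).  The characteristic equations of these say that
  \<open>c - \<nu>\<^sub>1 - i \<nu>\<^sub>5\<close> is a square root of a complex number \<open>discr \<nu>\<close>, or that
  \<open>c - \<nu>\<^sub>1 + i \<nu>\<^sub>5\<close> is one of its conjugate.  The two square roots are opposite, and a number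
  and its conjugate have square roots with the same real parts.  The parameter is therefore stable
  exactly when \<open>\<nu>\<^sub>1 + growth \<nu> < 0\<close>, where \<open>growth \<nu> \<ge> 0\<close> is the real part of the principal
  root of \<open>discr \<nu>\<close>.

  The growth is continuous and depends on \<open>\<nu>\<^sub>2, \<nu>\<^sub>3, \<nu>\<^sub>4\<close> alone, so \<open>\<nu>\<^sub>1 + growth \<nu>\<close> increases
  at unit speed along the first axis and the boundary is its zero set
  (\<open>frontier_stability_domain\<close>).  The bridge to the quartic is the factorization
  \<open>crit_fun \<nu> = (\<nu>\<^sub>1\<^sup>2 - r\<^sup>2) (\<nu>\<^sub>1\<^sup>2 + s\<^sup>2)\<close>, where \<open>r + i s\<close> is the principal root.  If
  \<open>\<nu>\<^sub>1 < 0\<close>, the second factor is positive and \<open>crit_fun \<nu> = 0\<close> means \<open>\<nu>\<^sub>1 = - r\<close>.  If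
  \<open>\<nu>\<^sub>1 = 0\<close>, the quartic also vanishes where \<open>s = 0\<close> and \<open>r > 0\<close>, which is off the boundary;
  the inequality \<open>\<nu>\<^sub>2\<^sup>2 \<le> \<nu>\<^sub>3\<^sup>2 + \<nu>\<^sub>4\<^sup>2\<close> excludes precisely these points.

  Transversality is a matter of homogeneity: the growth is positively homogeneous of degree 1 and
  the quartic is homogeneous of degree 4, so both hypersurfaces are cones with apex 0.  A cone
  contains the ray through each of its points \<open>p\<close>, hence \<open>p\<close> itself is a tangent direction at
  \<open>p\<close>, and it is not orthogonal to \<open>p\<close>.
\<close>

section \<open>The spectrum of the unfolding\<close>

lemma smult_append_vec: "c \<cdot>\<^sub>v (x @\<^sub>v y) = c \<cdot>\<^sub>v x @\<^sub>v c \<cdot>\<^sub>v y"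
  by (intro eq_vecI) auto

text \<open>
  For \<open>s = \<plusminus>i\<close> the map \<open>(x, y) \<mapsto> x - s y\<close> intertwines the block matrix with \<open>A + s B\<close>,
  because \<open>s\<^sup>2 = -1\<close> turns \<open>B y\<close> into \<open>s B (- s y)\<close>.
\<close>

lemma eigenvector_complex_structure_block:
  fixes A B :: "complex mat"
  assumes A: "A \<in> carrier_mat n n" and B: "B \<in> carrier_mat n n"
    and x: "x \<in> carrier_vec n" and y: "y \<in> carrier_vec n"
    and ev: "four_block_mat A B (- B) A *\<^sub>v (x @\<^sub>v y) = c \<cdot>\<^sub>v (x @\<^sub>v y)"
    and s: "s * s = -1"
  shows "(A + s \<cdot>\<^sub>m B) *\<^sub>v (x - s \<cdot>\<^sub>v y) = c \<cdot>\<^sub>v (x - s \<cdot>\<^sub>v y)"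
proof -
  have "(A *\<^sub>v x + B *\<^sub>v y) @\<^sub>v (- B *\<^sub>v x + A *\<^sub>v y) = c \<cdot>\<^sub>v x @\<^sub>v c \<cdot>\<^sub>v y"
    using ev four_block_mat_mult_vec[OF A B _ A x y, of "- B"] B x y
    by (simp add: smult_append_vec)
  then have eqs: "A *\<^sub>v x + B *\<^sub>v y = c \<cdot>\<^sub>v x" "- B *\<^sub>v x + A *\<^sub>v y = c \<cdot>\<^sub>v y"
    using A B x y append_vec_eq[of "A *\<^sub>v x + B *\<^sub>v y" n "c \<cdot>\<^sub>v x"] by simp_all
  show ?thesis
  proof (rule eq_vecI)
    fix i assume "i < dim_vec (c \<cdot>\<^sub>v (x - s \<cdot>\<^sub>v y))"
    then have i: "i < n" using y by simp
    have 1: "(A *\<^sub>v x) $ i + (B *\<^sub>v y) $ i = c * x $ i"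
      using arg_cong[OF eqs(1), of "\<lambda>v. v $ i"] A B x y i by simp
    have 2: "(A *\<^sub>v y) $ i - (B *\<^sub>v x) $ i = c * y $ i"
      using arg_cong[OF eqs(2), of "\<lambda>v. v $ i"] A B x y i by simp
    have "((A + s \<cdot>\<^sub>m B) *\<^sub>v (x - s \<cdot>\<^sub>v y)) $ i =
      (A *\<^sub>v x) $ i - s * (A *\<^sub>v y) $ i + s * ((B *\<^sub>v x) $ i - s * (B *\<^sub>v y) $ i)"
      using A B x y i
      by (simp add: add_mult_distrib_mat_vec[of _ n n] mult_minus_distrib_mat_vec[of _ n n]
          mult_mat_vec[of _ n n] algebra_simps)
    also have "\<dots> = ((A *\<^sub>v x) $ i + (B *\<^sub>v y) $ i) - s * ((A *\<^sub>v y) $ i - (B *\<^sub>v x) $ i)"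
      using s by (simp add: algebra_simps flip: mult.assoc)
    also have "\<dots> = c * (x $ i - s * y $ i)"
      unfolding 1 2 by (simp add: algebra_simps)
    finally show "((A + s \<cdot>\<^sub>m B) *\<^sub>v (x - s \<cdot>\<^sub>v y)) $ i = (c \<cdot>\<^sub>v (x - s \<cdot>\<^sub>v y)) $ i"
      using x y i by simp
  qed (use A B x y in simp)
qed

text \<open>
  The maps \<open>x - i y\<close> and \<open>x + i y\<close> together are injective, so a non-zero eigenvector of the block
  matrix has a non-zero image under at least one of them.  Conversely, an eigenvector \<open>w\<close> of
  \<open>A + s B\<close> lifts to \<open>(w, s w)\<close>.
\<close>

lemma eigenvalue_complex_structure_block:
  fixes A B :: "complex mat"
  assumes A: "A \<in> carrier_mat n n" and B: "B \<in> carrier_mat n n"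
  shows "eigenvalue (four_block_mat A B (- B) A) c \<longleftrightarrow>
    eigenvalue (A + \<i> \<cdot>\<^sub>m B) c \<or> eigenvalue (A + (- \<i>) \<cdot>\<^sub>m B) c"
proof
  assume "eigenvalue (four_block_mat A B (- B) A) c"
  then obtain v where v: "v \<in> carrier_vec (n + n)" "v \<noteq> 0\<^sub>v (n + n)"
    and ev: "four_block_mat A B (- B) A *\<^sub>v v = c \<cdot>\<^sub>v v"
    using A B unfolding eigenvalue_def eigenvector_def by auto
  define x y where "x = vec_first v n" and "y = vec_last v n"
  have x: "x \<in> carrier_vec n" and y: "y \<in> carrier_vec n" and vxy: "v = x @\<^sub>v y"
    using v(1) unfolding x_def y_def by auto
  have ev_s: "eigenvalue (A + s \<cdot>\<^sub>m B) c" if "s * s = -1" "x - s \<cdot>\<^sub>v y \<noteq> 0\<^sub>v n" for s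
    using eigenvector_complex_structure_block[OF A B x y _ that(1), of c] ev that(2) A B x y
    unfolding eigenvalue_def eigenvector_def vxy
    by (intro exI[of _ "x - s \<cdot>\<^sub>v y"]) auto
  have "x - \<i> \<cdot>\<^sub>v y \<noteq> 0\<^sub>v n \<or> x - (- \<i>) \<cdot>\<^sub>v y \<noteq> 0\<^sub>v n"
  proof (rule ccontr)
    assume "\<not> ?thesis"
    then have *: "x - \<i> \<cdot>\<^sub>v y = 0\<^sub>v n" "x - (- \<i>) \<cdot>\<^sub>v y = 0\<^sub>v n" by auto
    have "x $ i = 0 \<and> y $ i = 0" if i: "i < n" for i
    proof -
      have "x $ i - \<i> * y $ i = 0" "x $ i + \<i> * y $ i = 0"
        using arg_cong[OF *(1), of "\<lambda>v. v $ i"] arg_cong[OF *(2), of "\<lambda>v. v $ i"] x y i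
        by simp_all
      then have "x $ i = \<i> * y $ i" "2 * (\<i> * y $ i) = 0" by auto
      then show ?thesis by simp
    qed
    then have "x @\<^sub>v y = 0\<^sub>v (n + n)"
      using x y by (intro eq_vecI) (auto simp: append_vec_def Let_def)
    with v(2) vxy show False by simp
  qed
  then show "eigenvalue (A + \<i> \<cdot>\<^sub>m B) c \<or> eigenvalue (A + (- \<i>) \<cdot>\<^sub>m B) c"
    using ev_s[of \<i>] ev_s[of "- \<i>"] by auto
next
  have "eigenvalue (four_block_mat A B (- B) A) c"
    if s: "s * s = -1" and ev: "eigenvalue (A + s \<cdot>\<^sub>m B) c" for s
  proof -
    obtain w where w: "w \<in> carrier_vec n" "w \<noteq> 0\<^sub>v n" and eq: "(A + s \<cdot>\<^sub>m B) *\<^sub>v w = c \<cdot>\<^sub>v w"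
      using ev A B unfolding eigenvalue_def eigenvector_def by auto
    have sw: "s \<cdot>\<^sub>v w \<in> carrier_vec n" using w by simp
    have comp: "(A *\<^sub>v w) $ i + s * (B *\<^sub>v w) $ i = c * w $ i" if i: "i < n" for i
      using arg_cong[OF eq, of "\<lambda>v. v $ i"] A B w i
      by (simp add: add_mult_distrib_mat_vec[of _ n n])
    have top: "A *\<^sub>v w + B *\<^sub>v (s \<cdot>\<^sub>v w) = c \<cdot>\<^sub>v w"
      using A B w comp by (intro eq_vecI) (auto simp: mult_mat_vec[of _ n n])
    have bot: "- B *\<^sub>v w + A *\<^sub>v (s \<cdot>\<^sub>v w) = c \<cdot>\<^sub>v (s \<cdot>\<^sub>v w)"
    proof (rule eq_vecI)
      fix i assume "i < dim_vec (c \<cdot>\<^sub>v (s \<cdot>\<^sub>v w))"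
      then have i: "i < n" using w by simp
      have "c * (s * w $ i) = s * ((A *\<^sub>v w) $ i + s * (B *\<^sub>v w) $ i)"
        unfolding comp[OF i] by (simp add: ac_simps)
      also have "\<dots> = - ((B *\<^sub>v w) $ i) + s * (A *\<^sub>v w) $ i"
        using s by (simp add: distrib_left flip: mult.assoc)
      finally have "- ((B *\<^sub>v w) $ i) + s * (A *\<^sub>v w) $ i = c * (s * w $ i)" ..
      then show "(- B *\<^sub>v w + A *\<^sub>v (s \<cdot>\<^sub>v w)) $ i = (c \<cdot>\<^sub>v (s \<cdot>\<^sub>v w)) $ i"
        using A B w i by (simp add: mult_mat_vec[of _ n n])
    qed (use A B w in simp)
    have "four_block_mat A B (- B) A *\<^sub>v (w @\<^sub>v s \<cdot>\<^sub>v w) = c \<cdot>\<^sub>v (w @\<^sub>v s \<cdot>\<^sub>v w)"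
      using four_block_mat_mult_vec[OF A B _ A w(1) sw, of "- B"] B top bot
      by (simp add: smult_append_vec)
    moreover have "w @\<^sub>v s \<cdot>\<^sub>v w \<noteq> 0\<^sub>v (n + n)"
    proof
      assume "w @\<^sub>v s \<cdot>\<^sub>v w = 0\<^sub>v (n + n)"
      then have "w $ i = 0" if "i < n" for i
        using arg_cong[of _ _ "\<lambda>v. v $ i"] that w(1)
        by (metis (no_types, lifting) carrier_vecD index_append_vec(1) index_zero_vec(1) trans_less_add1)
      with w show False by auto
    qed
    ultimately show ?thesis
      using A B w unfolding eigenvalue_def eigenvector_def
      by (intro exI[of _ "w @\<^sub>v s \<cdot>\<^sub>v w"]) auto
  qed
  from this[of \<i>] this[of "- \<i>"]
  show "eigenvalue (A + \<i> \<cdot>\<^sub>m B) c \<or> eigenvalue (A + (- \<i>) \<cdot>\<^sub>m B) c \<Longrightarrow>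
    eigenvalue (four_block_mat A B (- B) A) c"
    by auto
qed

lemma eigenvalue_2x2:
  fixes A :: "'a::field mat"
  assumes A: "A \<in> carrier_mat 2 2"
  shows "eigenvalue A c \<longleftrightarrow>
    (A $$ (0,0) - c) * (A $$ (1,1) - c) - A $$ (0,1) * A $$ (1,0) = 0"
proof -
  have "det M = M $$ (0,0) * M $$ (1,1) - M $$ (0,1) * M $$ (1,0)"
    if M: "M \<in> carrier_mat 2 2" for M :: "'a mat"
    using M
    by (simp add: laplace_expansion_row[OF M, of 0] cofactor_def numeral_2_eq_2 mat_delete_def
        det_single)
  from this[of "char_matrix A c"] show ?thesis
    using A unfolding eigenvalue_det[OF A] by (simp add: char_matrix_def)
qed

text \<open>
  Up to the scalar part, \<open>A + i B\<close> is the traceless matrix \<open>(\<nu>\<^sub>4 + i \<nu>\<^sub>2) J + i \<nu>\<^sub>3 R\<close>.  As \<open>J\<close> and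
  \<open>R\<close> anticommute with \<open>J\<^sup>2 = - I\<close> and \<open>R\<^sup>2 = I\<close>, its square is the scalar
  \<open>- (\<nu>\<^sub>4 + i \<nu>\<^sub>2)\<^sup>2 - \<nu>\<^sub>3\<^sup>2\<close>, which is the number below.
\<close>

definition discr :: "real ^ 4 \<Rightarrow> complex" where
  "discr \<nu> = Complex ((vec_nth \<nu> 2)\<^sup>2 - (vec_nth \<nu> 3)\<^sup>2 - (vec_nth \<nu> 4)\<^sup>2)
    (- 2 * vec_nth \<nu> 2 * vec_nth \<nu> 4)"

lemma reduced_unfolding_blocks:
  "reduced_unfolding \<nu>5 \<nu> =
    four_block_mat
      (mat_of_rows_list 2 [[vec_nth \<nu> 1, vec_nth \<nu> 4], [- vec_nth \<nu> 4, vec_nth \<nu> 1]])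
      (mat_of_rows_list 2 [[\<nu>5 + vec_nth \<nu> 3, vec_nth \<nu> 2], [- vec_nth \<nu> 2, \<nu>5 - vec_nth \<nu> 3]])
      (- mat_of_rows_list 2 [[\<nu>5 + vec_nth \<nu> 3, vec_nth \<nu> 2], [- vec_nth \<nu> 2, \<nu>5 - vec_nth \<nu> 3]])
      (mat_of_rows_list 2 [[vec_nth \<nu> 1, vec_nth \<nu> 4], [- vec_nth \<nu> 4, vec_nth \<nu> 1]])"
    (is "_ = ?M")
proof (rule eq_matI)
  fix i j assume "i < dim_row ?M" "j < dim_col ?M"
  then have "i \<in> {0, 1, 2, 3}" "j \<in> {0, 1, 2, 3}"
    by (auto simp: mat_of_rows_list_def)
  then show "reduced_unfolding \<nu>5 \<nu> $$ (i, j) = ?M $$ (i, j)"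
    by (auto simp: reduced_unfolding_def M1_def M4_def M5_def M6_def M8_def mat_R_def mat_J_def
        mat_of_rows_list_def)
qed (auto simp: reduced_unfolding_def M1_def M4_def M5_def M6_def M8_def mat_R_def mat_J_def
        mat_of_rows_list_def)

lemma eigenvalue_reduced_unfolding:
  "eigenvalue (map_mat complex_of_real (reduced_unfolding \<nu>5 \<nu>)) c \<longleftrightarrow>
    (c - complex_of_real (vec_nth \<nu> 1) - \<i> * complex_of_real \<nu>5)\<^sup>2 = discr \<nu> \<or>
    (c - complex_of_real (vec_nth \<nu> 1) + \<i> * complex_of_real \<nu>5)\<^sup>2 = cnj (discr \<nu>)"
proof -
  let ?A = "mat_of_rows_list 2 [[vec_nth \<nu> 1, vec_nth \<nu> 4], [- vec_nth \<nu> 4, vec_nth \<nu> 1]]"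
  let ?B = "mat_of_rows_list 2
    [[\<nu>5 + vec_nth \<nu> 3, vec_nth \<nu> 2], [- vec_nth \<nu> 2, \<nu>5 - vec_nth \<nu> 3]]"
  define A B where "A = map_mat complex_of_real ?A" and "B = map_mat complex_of_real ?B"
  have A: "A \<in> carrier_mat 2 2" and B: "B \<in> carrier_mat 2 2"
    by (simp_all add: A_def B_def mat_of_rows_list_def numeral_2_eq_2)
  have carrier: "?A \<in> carrier_mat 2 2" "?B \<in> carrier_mat 2 2"
    by (simp_all add: mat_of_rows_list_def numeral_2_eq_2)
  have "map_mat complex_of_real (- ?B) = - B"
    unfolding B_def by (intro eq_matI) auto
  then have "map_mat complex_of_real (reduced_unfolding \<nu>5 \<nu>) = four_block_mat A B (- B) A"
    unfolding reduced_unfolding_blocks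
    using carrier by (subst map_four_block_mat[of _ 2 2 _ 2 _ 2]) (auto simp: A_def B_def)
  then have block: "eigenvalue (map_mat complex_of_real (reduced_unfolding \<nu>5 \<nu>)) c \<longleftrightarrow>
      eigenvalue (A + \<i> \<cdot>\<^sub>m B) c \<or> eigenvalue (A + (- \<i>) \<cdot>\<^sub>m B) c"
    using eigenvalue_complex_structure_block[OF A B] by simp
  have D: "discr \<nu> = (of_real (vec_nth \<nu> 2))\<^sup>2 - (of_real (vec_nth \<nu> 3))\<^sup>2 - (of_real (vec_nth \<nu> 4))\<^sup>2
      - 2 * \<i> * of_real (vec_nth \<nu> 2) * of_real (vec_nth \<nu> 4)"
    "cnj (discr \<nu>) = (of_real (vec_nth \<nu> 2))\<^sup>2 - (of_real (vec_nth \<nu> 3))\<^sup>2 - (of_real (vec_nth \<nu> 4))\<^sup>2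
      + 2 * \<i> * of_real (vec_nth \<nu> 2) * of_real (vec_nth \<nu> 4)"
    by (simp_all add: discr_def complex_eq_iff power2_eq_square)
  have plus: "eigenvalue (A + \<i> \<cdot>\<^sub>m B) c \<longleftrightarrow>
      (c - complex_of_real (vec_nth \<nu> 1) - \<i> * complex_of_real \<nu>5)\<^sup>2 = discr \<nu>"
    using A B
    by (subst eigenvalue_2x2)
      (auto simp: A_def B_def mat_of_rows_list_def D power2_eq_square algebra_simps)
  have minus: "eigenvalue (A + (- \<i>) \<cdot>\<^sub>m B) c \<longleftrightarrow>
      (c - complex_of_real (vec_nth \<nu> 1) + \<i> * complex_of_real \<nu>5)\<^sup>2 = cnj (discr \<nu>)"
    using A B
    by (subst eigenvalue_2x2)
      (auto simp: A_def B_def mat_of_rows_list_def D power2_eq_square algebra_simps)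
  show ?thesis unfolding block plus minus ..
qed

section \<open>The stability domain and its boundary\<close>

text \<open>The larger of the two real parts of the square roots of the discriminant.\<close>

definition growth :: "real ^ 4 \<Rightarrow> real" where
  "growth \<nu> = Re (csqrt (discr \<nu>))"

lemma all_square_roots_Re_less:
  "(\<forall>z. z\<^sup>2 = d \<longrightarrow> Re z < t) \<longleftrightarrow> Re (csqrt d) < t"
proof -
  have "z\<^sup>2 = d \<longleftrightarrow> z = csqrt d \<or> z = - csqrt d" for z
    by (metis power2_csqrt power2_eq_iff)
  moreover have "0 \<le> Re (csqrt d)"
    using csqrt_principal[of d] by auto
  ultimately show ?thesis
    by (metis le_less_trans neg_le_0_iff_le uminus_complex.sel(1))
qed

lemma stability_domain_eq:
  "stability_domain \<nu>5 = {\<nu>. vec_nth \<nu> 1 + growth \<nu> < 0}"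
proof -
  \<comment> \<open>The substitution \<open>c = z + a + i b\<close> moves real parts by \<open>a\<close>, whatever \<open>b\<close> is.\<close>
  have shift: "(\<forall>c. (c - complex_of_real a - \<i> * complex_of_real b)\<^sup>2 = d \<longrightarrow> Re c < 0)
      \<longleftrightarrow> (\<forall>z. z\<^sup>2 = d \<longrightarrow> Re z < - a)" for a b d
  proof (intro iffI allI impI)
    fix z assume "\<forall>c. (c - complex_of_real a - \<i> * complex_of_real b)\<^sup>2 = d \<longrightarrow> Re c < 0" "z\<^sup>2 = d"
    then show "Re z < - a"
      by (auto dest: spec[of _ "z + complex_of_real a + \<i> * complex_of_real b"])
  next
    fix c assume "\<forall>z. z\<^sup>2 = d \<longrightarrow> Re z < - a" "(c - complex_of_real a - \<i> * complex_of_real b)\<^sup>2 = d"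
    then show "Re c < 0"
      by (auto dest: spec[of _ "c - complex_of_real a - \<i> * complex_of_real b"])
  qed
  have shift': "(\<forall>c. (c - complex_of_real a + \<i> * complex_of_real b)\<^sup>2 = d \<longrightarrow> Re c < 0)
      \<longleftrightarrow> (\<forall>z. z\<^sup>2 = d \<longrightarrow> Re z < - a)" for a b d
    using shift[of a "- b" d] by simp
  show ?thesis
    unfolding stability_domain_def eigenvalue_reduced_unfolding imp_disjL all_conj_distrib
      shift shift' all_square_roots_Re_less growth_def
    by auto
qed

text \<open>
  The principal root jumps across the negative real axis, but only in its imaginary part; the real
  part is \<open>sqrt ((\<bar>z\<bar> + Re z) / 2)\<close>.
\<close>

lemma continuous_on_growth: "continuous_on UNIV growth"
  unfolding growth_def discr_def csqrt.simps cmod_def complex.sel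
  by (intro continuous_intros) auto

lemma growth_nonneg: "0 \<le> growth \<nu>"
  using csqrt_principal[of "discr \<nu>"] by (auto simp: growth_def)

lemma growth_scaleR:
  assumes "0 \<le> t"
  shows "growth (t *\<^sub>R \<nu>) = t * growth \<nu>"
proof -
  have "discr (t *\<^sub>R \<nu>) = complex_of_real (t\<^sup>2) * discr \<nu>"
    by (simp add: discr_def complex_eq_iff power2_eq_square algebra_simps)
  then show ?thesis
    using assms
    by (simp add: growth_def norm_mult norm_power real_sqrt_mult flip: distrib_left
        times_divide_eq_right of_real_power)
qed

text \<open>
  With \<open>r + i s\<close> the principal root, the product is
  \<open>\<nu>\<^sub>1\<^sup>4 - \<nu>\<^sub>1\<^sup>2 (r\<^sup>2 - s\<^sup>2) - (r s)\<^sup>2\<close>, and \<open>r\<^sup>2 - s\<^sup>2\<close> and \<open>2 r s\<close> are the real and the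
  imaginary part of the discriminant.
\<close>

lemma crit_fun_factorization:
  "crit_fun \<nu> = ((vec_nth \<nu> 1)\<^sup>2 - (growth \<nu>)\<^sup>2) * ((vec_nth \<nu> 1)\<^sup>2 + (Im (csqrt (discr \<nu>)))\<^sup>2)"
proof -
  define r s where "r = growth \<nu>" and "s = Im (csqrt (discr \<nu>))"
  have "csqrt (discr \<nu>) = Complex r s"
    unfolding r_def s_def growth_def by (rule complex.collapse[symmetric])
  with power2_csqrt[of "discr \<nu>"] have "(Complex r s)\<^sup>2 = discr \<nu>" by simp
  then have diff: "r\<^sup>2 - s\<^sup>2 = (vec_nth \<nu> 2)\<^sup>2 - (vec_nth \<nu> 3)\<^sup>2 - (vec_nth \<nu> 4)\<^sup>2"
    and prod: "r * s = - vec_nth \<nu> 2 * vec_nth \<nu> 4"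
    by (simp_all add: complex_eq_iff discr_def power2_eq_square)
  have "((vec_nth \<nu> 1)\<^sup>2 - r\<^sup>2) * ((vec_nth \<nu> 1)\<^sup>2 + s\<^sup>2)
      = ((vec_nth \<nu> 1)\<^sup>2)\<^sup>2 - (vec_nth \<nu> 1)\<^sup>2 * (r\<^sup>2 - s\<^sup>2) - (r * s)\<^sup>2"
    by (simp add: power2_eq_square algebra_simps)
  also have "\<dots> = crit_fun \<nu>"
    unfolding diff prod crit_fun_def by (simp add: power2_eq_square algebra_simps)
  finally show ?thesis
    unfolding r_def s_def ..
qed

text \<open>
  Zeros of a continuous function need not be boundary points of its negativity set.  Here they
  are, since moving backwards along \<open>e\<close> makes the function negative at once.
\<close>

lemma frontier_sublevel_translation:
  fixes h :: "'a::real_normed_vector \<Rightarrow> real"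
  assumes cont: "continuous_on UNIV h" and transl: "\<And>x t. h (x + t *\<^sub>R e) = h x + t"
  shows "frontier {x. h x < 0} = {x. h x = 0}"
proof -
  have "open {x. h x < 0}"
    using cont by (simp add: open_Collect_less)
  moreover have "closure {x. h x < 0} = {x. h x \<le> 0}"
  proof
    show "closure {x. h x < 0} \<subseteq> {x. h x \<le> 0}"
      using cont by (intro closure_minimal) (auto intro: closed_Collect_le)
    show "{x. h x \<le> 0} \<subseteq> closure {x. h x < 0}"
    proof
      fix x assume "x \<in> {x. h x \<le> 0}"
      then have "\<forall>n. x + (- inverse (real (Suc n))) *\<^sub>R e \<in> {x. h x < 0}"
        unfolding mem_Collect_eq transl by (intro allI add_nonpos_neg) auto
      moreover have "(\<lambda>n. x + (- inverse (real (Suc n))) *\<^sub>R e) \<longlonglongrightarrow> x + (- 0) *\<^sub>R e"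
        by (intro tendsto_intros LIMSEQ_inverse_real_of_nat)
      ultimately show "x \<in> closure {x. h x < 0}"
        unfolding closure_sequential by (intro exI conjI) auto
    qed
  qed
  ultimately show ?thesis
    by (auto simp: frontier_def interior_open)
qed

lemma frontier_stability_domain:
  "frontier (stability_domain \<nu>5) = {\<nu>. vec_nth \<nu> 1 + growth \<nu> = 0}"
  unfolding stability_domain_eq
proof (rule frontier_sublevel_translation[where e = "axis 1 1"])
  show "continuous_on UNIV (\<lambda>\<nu>. vec_nth \<nu> 1 + growth \<nu>)"
    by (intro continuous_intros continuous_on_growth)
  show "vec_nth (\<nu> + t *\<^sub>R axis 1 1) 1 + growth (\<nu> + t *\<^sub>R axis 1 1) = vec_nth \<nu> 1 + growth \<nu> + t"
    for \<nu> :: "real ^ 4" and t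
    by (simp add: growth_def discr_def axis_def)
qed

lemma growth_eq_0_iff:
  "growth \<nu> = 0 \<longleftrightarrow> vec_nth \<nu> 2 * vec_nth \<nu> 4 = 0 \<and>
    (vec_nth \<nu> 2)\<^sup>2 \<le> (vec_nth \<nu> 3)\<^sup>2 + (vec_nth \<nu> 4)\<^sup>2"
proof -
  have "growth \<nu> = 0 \<longleftrightarrow> cmod (discr \<nu>) = - Re (discr \<nu>)"
    by (auto simp: growth_def)
  also have "\<dots> \<longleftrightarrow> Im (discr \<nu>) = 0 \<and> Re (discr \<nu>) \<le> 0"
    using cmod_power2[of "discr \<nu>"] norm_ge_zero[of "discr \<nu>"]
    by (auto simp: cmod_eq_Re)
  finally show ?thesis
    by (auto simp: discr_def)
qed

text \<open>
  For \<open>\<nu>\<^sub>1 = 0\<close> the quartic reduces to \<open>- \<nu>\<^sub>2\<^sup>2 \<nu>\<^sub>4\<^sup>2\<close>, which forces the discriminant to be real;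
  the growth then vanishes only if the discriminant is also non-positive.
\<close>

lemma frontier_iff_critical:
  "vec_nth \<nu> 1 + growth \<nu> = 0 \<longleftrightarrow> crit_fun \<nu> = 0 \<and> vec_nth \<nu> 1 \<le> 0 \<and>
    (vec_nth \<nu> 1 = 0 \<longrightarrow> (vec_nth \<nu> 2)\<^sup>2 \<le> (vec_nth \<nu> 3)\<^sup>2 + (vec_nth \<nu> 4)\<^sup>2)"
proof (cases "vec_nth \<nu> 1 = 0")
  case True
  then show ?thesis
    by (auto simp: growth_eq_0_iff crit_fun_def)
next
  case False
  then have "0 < (vec_nth \<nu> 1)\<^sup>2 + (Im (csqrt (discr \<nu>)))\<^sup>2"
    by (simp add: sum_power2_gt_zero_iff)
  then have "crit_fun \<nu> = 0 \<longleftrightarrow> (vec_nth \<nu> 1)\<^sup>2 = (growth \<nu>)\<^sup>2"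
    unfolding crit_fun_factorization by auto
  then show ?thesis
    using False growth_nonneg[of \<nu>] by (auto simp: power2_eq_iff)
qed

section \<open>Cones\<close>

text \<open>
  The points \<open>(1 + 1/n) p\<close> of the cone tend to \<open>p\<close>, and their secant vectors rescaled by \<open>n\<close>
  are all equal to \<open>p\<close>.  So the normal vector \<open>p\<close> of the sphere is a tangent direction.
\<close>

lemma transversal_to_unit_sphere_cone:
  fixes X :: "'a::real_inner set"
  assumes "\<And>x t. x \<in> X \<Longrightarrow> 0 \<le> t \<Longrightarrow> t *\<^sub>R x \<in> X"
  shows "transversal_to_unit_sphere X"
  unfolding transversal_to_unit_sphere_def
proof (intro ballI notI)
  fix p assume p: "p \<in> X \<inter> sphere 0 1"
    and sub: "tangent_cone X p \<subseteq> {v. inner p v = 0}"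
  have "(\<lambda>n. (1 + inverse (real (Suc n))) *\<^sub>R p) \<longlonglongrightarrow> (1 + 0) *\<^sub>R p"
    by (intro tendsto_intros LIMSEQ_inverse_real_of_nat)
  moreover have "real (Suc n) *\<^sub>R ((1 + inverse (real (Suc n))) *\<^sub>R p - p) = p" for n
    by (simp add: scaleR_add_left del: of_nat_Suc)
  ultimately have "p \<in> tangent_cone X p"
    unfolding tangent_cone_def using p assms
    by (intro CollectI exI[of _ "\<lambda>n. (1 + inverse (real (Suc n))) *\<^sub>R p"]
        exI[of _ "\<lambda>n. real (Suc n)"]) auto
  with sub have "inner p p = 0" by auto
  with p show False by simp
qed

text \<open>
  A point of the sphere in \<open>X\<close> is needed to write the apex as \<open>0 \<xi>\<close>; without one, \<open>X = {0}\<close>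
  would be a counterexample.
\<close>

lemma closed_under_scaling_eq_cone_over_sphere:
  fixes X :: "'a::real_normed_vector set"
  assumes cone: "\<And>x t. x \<in> X \<Longrightarrow> 0 \<le> t \<Longrightarrow> t *\<^sub>R x \<in> X"
    and nonempty: "X \<inter> sphere 0 1 \<noteq> {}"
  shows "X = {t *\<^sub>R \<xi> | t \<xi>. 0 \<le> t \<and> \<xi> \<in> X \<inter> sphere 0 1}"
proof (intro equalityI subsetI)
  fix x assume x: "x \<in> X"
  show "x \<in> {t *\<^sub>R \<xi> | t \<xi>. 0 \<le> t \<and> \<xi> \<in> X \<inter> sphere 0 1}"
  proof (cases "x = 0")
    case True
    obtain \<xi> where "\<xi> \<in> X \<inter> sphere 0 1" using nonempty by blast
    with True show ?thesis
      by (intro CollectI exI[of _ 0] exI[of _ \<xi>]) auto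
  next
    case False
    then have "x = norm x *\<^sub>R (inverse (norm x) *\<^sub>R x)" by simp
    with False cone[OF x, of "inverse (norm x)"] show ?thesis
      by (intro CollectI exI[of _ "norm x"] exI[of _ "inverse (norm x) *\<^sub>R x"]) auto
  qed
qed (use cone in auto)

lemma crit_fun_scaleR: "crit_fun (t *\<^sub>R \<nu>) = t ^ 4 * crit_fun \<nu>"
  by (simp add: crit_fun_def power2_eq_square power4_eq_xxxx algebra_simps)

theorem lemma2p4:
  fixes \<nu>5 :: real
  assumes "\<nu>5 \<noteq> 0"
  shows "frontier (stability_domain \<nu>5) \<inter> sphere 0 1 =
        {\<nu> \<in> critical_surface. vec_nth \<nu> 1 \<le> 0 \<and>
          (vec_nth \<nu> 1 = 0 \<longrightarrow> (vec_nth \<nu> 2)\<^sup>2 \<le> (vec_nth \<nu> 3)\<^sup>2 + (vec_nth \<nu> 4)\<^sup>2)}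
    \<and> transversal_to_unit_sphere (frontier (stability_domain \<nu>5))
    \<and> critical_set \<inter> sphere 0 1 = critical_surface
    \<and> transversal_to_unit_sphere critical_set
    \<and> critical_set = {t *\<^sub>R \<xi> | t \<xi>. 0 \<le> t \<and> \<xi> \<in> critical_surface}"
proof (intro conjI)
  show "frontier (stability_domain \<nu>5) \<inter> sphere 0 1 =
        {\<nu> \<in> critical_surface. vec_nth \<nu> 1 \<le> 0 \<and>
          (vec_nth \<nu> 1 = 0 \<longrightarrow> (vec_nth \<nu> 2)\<^sup>2 \<le> (vec_nth \<nu> 3)\<^sup>2 + (vec_nth \<nu> 4)\<^sup>2)}"
    unfolding frontier_stability_domain frontier_iff_critical
    by (auto simp: critical_surface_def)
  show "transversal_to_unit_sphere (frontier (stability_domain \<nu>5))"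
    unfolding frontier_stability_domain
    by (rule transversal_to_unit_sphere_cone)
      (auto simp: growth_scaleR simp flip: distrib_left)
  show surface: "critical_set \<inter> sphere 0 1 = critical_surface"
    by (auto simp: critical_set_def critical_surface_def)
  have cone: "t *\<^sub>R \<nu> \<in> critical_set" if "\<nu> \<in> critical_set" for t \<nu>
    using that by (simp add: critical_set_def crit_fun_scaleR)
  then show "transversal_to_unit_sphere critical_set"
    by (rule transversal_to_unit_sphere_cone)
  have "crit_fun (axis 3 1) = 0"
    by (simp add: crit_fun_def axis_def)
  then have "axis 3 1 \<in> critical_set \<inter> sphere 0 1"
    by (simp add: critical_set_def)
  then show "critical_set = {t *\<^sub>R \<xi> | t \<xi>. 0 \<le> t \<and> \<xi> \<in> critical_surface}"
    using closed_under_scaling_eq_cone_over_sphere[of critical_set] cone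
    unfolding surface by blast
qed

end
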